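(* Let $G$ be a finite simple undirected graph with no isolated vertices. If $1\leq \delta(G)\leq 2$, then $\gamma_t(G)\leq 2\mu^*(G)$. If $\delta(G)\geq 3$, then $\gamma_t(G)\leq 2\mu^*(G)-\delta(G)+2$.
   Context: $\delta(G)$ is the minimum degree of $G$. A set $S\subseteq V(G)$ is a total dominating set of $G$ if every vertex of $V(G)$ (including those in $S$) is adjacent to a member of $S$; $\gamma_t(G)$ is the minimum cardinality of a total dominating set (defined when $G$ has no isolated vertices). A matching is a set of pairwise disjoint edges; a maximal matching is a matching not contained in a larger matching; $\mu^*(G)$ is the minimum cardinality of a maximal matching of $G$. *)

theory Defs
  imports Main
begin

locale simple_graph =
  fixes V :: "'a set" and E :: "'a set set"
  assumes finite_vertices: "finite V"
    and nonempty_vertices: "V \<noteq> {}"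
    and edges_wf: "\<And>e. e \<in> E \<Longrightarrow> e \<subseteq> V \<and> card e = 2"

definition neighborhood :: "'a set \<Rightarrow> 'a set set \<Rightarrow> 'a \<Rightarrow> 'a set" where
  "neighborhood V E v = {u \<in> V. {u, v} \<in> E}"

definition degree :: "'a set \<Rightarrow> 'a set set \<Rightarrow> 'a \<Rightarrow> nat" where
  "degree V E v = card (neighborhood V E v)"

definition min_degree :: "'a set \<Rightarrow> 'a set set \<Rightarrow> nat" where
  "min_degree V E = Min (degree V E ` V)"

definition no_isolated_vertices :: "'a set \<Rightarrow> 'a set set \<Rightarrow> bool" where
  "no_isolated_vertices V E \<longleftrightarrow> (\<forall>v\<in>V. neighborhood V E v \<noteq> {})"

definition total_dominating_set :: "'a set \<Rightarrow> 'a set set \<Rightarrow> 'a set \<Rightarrow> bool" where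
  "total_dominating_set V E S \<longleftrightarrow> S \<subseteq> V \<and> (\<forall>v\<in>V. \<exists>s\<in>S. {s, v} \<in> E)"

definition total_domination_number :: "'a set \<Rightarrow> 'a set set \<Rightarrow> nat" where
  "total_domination_number V E = Min (card ` {S. total_dominating_set V E S})"

definition matching :: "'a set set \<Rightarrow> 'a set set \<Rightarrow> bool" where
  "matching E M \<longleftrightarrow> M \<subseteq> E \<and> pairwise disjnt M"

definition maximal_matching :: "'a set set \<Rightarrow> 'a set set \<Rightarrow> bool" where
  "maximal_matching E M \<longleftrightarrow> matching E M \<and> \<not> (\<exists>M'. matching E M' \<and> M \<subset> M')"

definition min_maximal_matching_number :: "'a set set \<Rightarrow> nat" where
  "min_maximal_matching_number E = Min (card ` {M. maximal_matching E M})"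

text \<open>The three minima above are over finite nonempty sets, so they are attained.\<close>

context simple_graph
begin

lemma finite_edges: "finite E"
  by (rule finite_subset[of _ "Pow V"]) (use edges_wf finite_vertices in auto)

lemma degrees_finite_nonempty:
  "finite (degree V E ` V)" "degree V E ` V \<noteq> {}"
  using finite_vertices nonempty_vertices by auto

lemma total_dominating_sets_finite: "finite {S. total_dominating_set V E S}"
  by (rule finite_subset[of _ "Pow V"])
    (use finite_vertices in \<open>auto simp: total_dominating_set_def\<close>)

lemma total_dominating_sets_nonempty:
  assumes "no_isolated_vertices V E"
  shows "{S. total_dominating_set V E S} \<noteq> {}"
proof -
  have "total_dominating_set V E V"
    using assms
    by (auto simp: total_dominating_set_def no_isolated_vertices_def neighborhood_def)
  then show ?thesis by blast
qed

lemma maximal_matchings_finite: "finite {M. maximal_matching E M}"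
  by (rule finite_subset[of _ "Pow E"])
    (use finite_edges in \<open>auto simp: maximal_matching_def matching_def\<close>)

lemma maximal_matchings_nonempty: "{M. maximal_matching E M} \<noteq> {}"
proof -
  have "finite {M. matching E M}"
    by (rule finite_subset[of _ "Pow E"]) (use finite_edges in \<open>auto simp: matching_def\<close>)
  moreover have "matching E {}"
    by (simp add: matching_def)
  ultimately obtain M where "matching E M"
      and "\<And>M'. matching E M' \<Longrightarrow> M \<subseteq> M' \<Longrightarrow> M = M'"
    using finite_has_maximal[of "{M. matching E M}"] by blast
  then have "maximal_matching E M"
    unfolding maximal_matching_def by blast
  then show ?thesis by blast
qed

end

end

theory Submission
  imports Defs
begin

text \<open>The vertices covered by a maximal matching \<open>M\<close> form a total dominating set of size
  \<open>2\<cdot>card M\<close>, since the uncovered vertices are independent. To save \<open>\<delta> - 2\<close> vertices when some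
  vertex \<open>y\<close> is uncovered, add \<open>y\<close> and discard \<open>\<delta> - 1\<close> of the \<open>M\<close>-partners of neighbours
  of \<open>y\<close>: the vertices that lose their partner are dominated by \<open>y\<close>, and \<open>y\<close> and every other
  uncovered vertex had at least \<open>\<delta>\<close> covered neighbours. If all vertices are covered, any
  \<open>\<delta> - 1\<close> of them can be discarded.\<close>

lemma total_domination_number_le:
  assumes "simple_graph V E" "total_dominating_set V E S"
  shows "total_domination_number V E \<le> card S"
  unfolding total_domination_number_def
  using simple_graph.total_dominating_sets_finite[OF assms(1)] assms(2) by (intro Min_le) auto

lemma min_degree_le:
  assumes "simple_graph V E" "v \<in> V"
  shows "min_degree V E \<le> degree V E v"
  unfolding min_degree_def
  using simple_graph.degrees_finite_nonempty[OF assms(1)] assms(2) by (intro Min_le) auto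

lemma min_maximal_matching_attained:
  assumes "simple_graph V E"
  obtains M where "maximal_matching E M" "card M = min_maximal_matching_number E"
proof -
  have "Min (card ` {M. maximal_matching E M}) \<in> card ` {M. maximal_matching E M}"
    using simple_graph.maximal_matchings_finite[OF assms]
      simple_graph.maximal_matchings_nonempty[OF assms] by (intro Min_in) auto
  then show ?thesis
    using that unfolding min_maximal_matching_number_def by auto
qed

lemma card_matching_vertices:
  assumes "simple_graph V E" "matching E M"
  shows "card (\<Union>M) = 2 * card M"
proof -
  have e: "card e = 2" if "e \<in> M" for e
    using that assms(2) simple_graph.edges_wf[OF assms(1)] by (auto simp: matching_def)
  then have "card (\<Union>M) = sum card M"
    using assms(2) unfolding matching_def
    by (intro card_Union_disjoint) (auto intro: card_ge_0_finite)
  then show ?thesis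
    using e by simp
qed

lemma matching_vertices_subset:
  assumes "simple_graph V E" "matching E M"
  shows "\<Union>M \<subseteq> V"
proof (rule Union_least)
  fix e assume "e \<in> M"
  then have "e \<in> E" using assms(2) by (auto simp: matching_def)
  then show "e \<subseteq> V" using simple_graph.edges_wf[OF assms(1)] by simp
qed

text \<open>If both ends were uncovered, the edge could be added to \<open>M\<close>, against
  maximality. Hence every neighbour of an uncovered vertex is covered.\<close>

lemma maximal_matching_covers_edge:
  assumes "maximal_matching E M" "{u, v} \<in> E" "v \<notin> \<Union>M"
  shows "u \<in> \<Union>M"
proof (rule ccontr)
  assume "u \<notin> \<Union>M"
  then have "matching E (insert {u, v} M)"
    using assms by (auto simp: maximal_matching_def matching_def pairwise_insert disjnt_def)
  moreover have "M \<subset> insert {u, v} M"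
    using assms(3) by auto
  ultimately show False
    using assms(1) unfolding maximal_matching_def by blast
qed

text \<open>Injectivity of the partner map is what later turns a count of neighbours into a count of
  their partners, and recovers a vertex from its partner.\<close>

lemma matching_partner:
  assumes "simple_graph V E" "matching E M"
  obtains p where "\<And>w. w \<in> \<Union>M \<Longrightarrow> {w, p w} \<in> M" "inj_on p (\<Union>M)"
proof -
  have "\<exists>u. {w, u} \<in> M" if w: "w \<in> \<Union>M" for w
  proof -
    obtain e where e: "e \<in> M" "w \<in> e" using w by blast
    then have "card e = 2"
      using assms(2) simple_graph.edges_wf[OF assms(1)] by (auto simp: matching_def)
    then obtain u where "e = {w, u}"
      using e(2) unfolding card_2_iff by auto
    then show ?thesis using e(1) by blast
  qed
  then obtain p where p: "\<And>w. w \<in> \<Union>M \<Longrightarrow> {w, p w} \<in> M"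
    by metis
  have "inj_on p (\<Union>M)"
  proof (rule inj_onI)
    fix a b assume ab: "a \<in> \<Union>M" "b \<in> \<Union>M" "p a = p b"
    \<comment> \<open>The edges at \<open>a\<close> and \<open>b\<close> share the vertex
      \<open>p a\<close>, so disjointness forces them to be the same edge.\<close>
    have "pairwise disjnt M" using assms(2) by (simp add: matching_def)
    moreover have "\<not> disjnt {a, p a} {b, p b}"
      using ab(3) by (simp add: disjnt_def)
    ultimately have "{a, p a} = {b, p b}"
      using pairwiseD p[OF ab(1)] p[OF ab(2)] by metis
    then show "a = b"
      using ab(3) by (auto simp: doubleton_eq_iff)
  qed
  with p show ?thesis by (rule that)
qed

text \<open>A covered vertex is dominated by its partner, an uncovered one by any of its
  neighbours.\<close>

lemma matching_vertices_total_dominating: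
  assumes G: "simple_graph V E" "no_isolated_vertices V E" and M: "maximal_matching E M"
  shows "total_dominating_set V E (\<Union>M)"
proof -
  have m: "matching E M" using M by (simp add: maximal_matching_def)
  obtain p where p: "\<And>w. w \<in> \<Union>M \<Longrightarrow> {w, p w} \<in> M"
    using matching_partner[OF G(1) m] by metis
  have "\<exists>s\<in>\<Union>M. {s, v} \<in> E" if v: "v \<in> V" for v
  proof (cases "v \<in> \<Union>M")
    case True
    then have "{p v, v} \<in> M" using p by (simp add: insert_commute)
    moreover from this have "{p v, v} \<in> E" using m by (auto simp: matching_def)
    ultimately show ?thesis by blast
  next
    case False
    obtain u where "{u, v} \<in> E"
      using G(2) v by (auto simp: no_isolated_vertices_def neighborhood_def)
    then show ?thesis
      using maximal_matching_covers_edge[OF M _ False] by blast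
  qed
  then show ?thesis
    using matching_vertices_subset[OF G(1) m] by (simp add: total_dominating_set_def)
qed

lemma neighbour_outside_small_set:
  assumes "card R < degree V E v" "finite R"
  obtains s where "s \<in> V" "{s, v} \<in> E" "s \<notin> R"
proof -
  have "\<not> neighborhood V E v \<subseteq> R"
    using assms(1) card_mono[OF assms(2)] unfolding degree_def by (meson not_le)
  then show ?thesis using that by (auto simp: neighborhood_def)
qed

text \<open>Here \<open>k\<close> is any positive lower bound on the degrees. The bound is written
  additively to avoid truncated subtraction.\<close>

lemma small_total_dominating_set:
  assumes G: "simple_graph V E" and M: "maximal_matching E M"
    and k: "1 \<le> k" "\<And>v. v \<in> V \<Longrightarrow> k \<le> degree V E v"
  obtains S where "total_dominating_set V E S" "card S + k \<le> 2 * card M + 2"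
proof -
  have m: "matching E M" using M by (simp add: maximal_matching_def)
  define W where "W = \<Union>M"
  have WV: "W \<subseteq> V" using matching_vertices_subset[OF G m] by (simp add: W_def)
  have fV: "finite V" using G by (rule simple_graph.finite_vertices)
  then have fW: "finite W" using WV finite_subset by blast
  have cW: "card W = 2 * card M" using card_matching_vertices[OF G m] by (simp add: W_def)
  \<comment> \<open>Discarding \<open>k - 1\<close> vertices cannot exhaust a neighbourhood of size
    at least \<open>k\<close>.\<close>
  have far: "\<exists>s\<in>V - R. {s, v} \<in> E" if v: "v \<in> V" and R: "R \<subseteq> W" "card R = k - 1" for v R
  proof -
    have "card R < degree V E v" using R(2) k(1) k(2)[OF v] by linarith
    then obtain s where "s \<in> V" "{s, v} \<in> E" "s \<notin> R"
      using neighbour_outside_small_set finite_subset[OF R(1) fW] by metis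
    then show ?thesis by blast
  qed
  \<comment> \<open>This is one better than the goal; the spare unit pays for adding
    \<open>y\<close> when some vertex is uncovered.\<close>
  have size: "card (W - R) + k \<le> 2 * card M + 1" if "R \<subseteq> W" "card R = k - 1" for R
    using that k(1) cW card_mono[OF fW that(1)] card_Diff_subset[OF finite_subset[OF that(1) fW] that(1)]
    by simp
  show ?thesis
  proof (cases "W = V")
    case True
    obtain v where v: "v \<in> V" using simple_graph.nonempty_vertices[OF G] by blast
    have "degree V E v \<le> card V"
      unfolding degree_def using fV by (intro card_mono) (auto simp: neighborhood_def)
    then have "k - 1 \<le> card W" using k(2)[OF v] True by simp
    then obtain R where R: "R \<subseteq> W" "card R = k - 1"
      by (meson obtain_subset_with_card_n)
    have "total_dominating_set V E (W - R)"
      using far[OF _ R] True by (auto simp: total_dominating_set_def)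
    then show ?thesis by (rule that) (use size[OF R] in simp)
  next
    case False
    then obtain y where y: "y \<in> V" "y \<notin> W" using WV by blast
    define A where "A = neighborhood V E y"
    have AW: "A \<subseteq> W"
      using maximal_matching_covers_edge[OF M] y(2) by (auto simp: A_def W_def neighborhood_def)
    obtain p where p: "\<And>w. w \<in> W \<Longrightarrow> {w, p w} \<in> M" "inj_on p W"
      using matching_partner[OF G m] unfolding W_def by metis
    have pW: "p w \<in> W" if "w \<in> W" for w
      using p(1)[OF that] by (auto simp: W_def)
    have "card (p ` A) = card A"
      using p(2) AW by (meson card_image inj_on_subset)
    then have "k - 1 \<le> card (p ` A)"
      using k(2)[OF y(1)] by (simp add: A_def degree_def)
    then obtain R where R: "R \<subseteq> p ` A" "card R = k - 1"
      by (meson obtain_subset_with_card_n)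
    have RW: "R \<subseteq> W" using R(1) AW pW by blast
    have "\<exists>s\<in>insert y (W - R). {s, v} \<in> E" if v: "v \<in> V" for v
    proof (cases "v \<in> W")
      case True
      show ?thesis
      proof (cases "p v \<in> R")
        case True
        \<comment> \<open>\<open>p v\<close> is also the partner of some member of \<open>A\<close>,
          and injectivity of \<open>p\<close> identifies that member with \<open>v\<close>.\<close>
        then have "v \<in> A"
          using R(1) AW p(2) \<open>v \<in> W\<close> by (auto simp: inj_on_def)
        then show ?thesis by (auto simp: A_def neighborhood_def insert_commute)
      next
        case False
        have "{p v, v} \<in> E"
          using p(1)[OF True] m by (auto simp: matching_def insert_commute)
        then show ?thesis using False pW[OF True] by blast
      qed
    next
      case False
      \<comment> \<open>The neighbour of \<open>v\<close> that survives outside \<open>R\<close> is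
        covered by maximality, so it lies in \<open>W - R\<close>. This includes
        \<open>v = y\<close>, which cannot dominate itself.\<close>
      then show ?thesis
        using far[OF v RW R(2)] maximal_matching_covers_edge[OF M] unfolding W_def by blast
    qed
    then have "total_dominating_set V E (insert y (W - R))"
      using y(1) WV by (auto simp: total_dominating_set_def)
    moreover have "card (insert y (W - R)) + k \<le> 2 * card M + 2"
      using size[OF RW R(2)] y(2) fW by simp
    ultimately show ?thesis by (rule that)
  qed
qed

theorem proposition2p3:
  fixes V :: "'a set" and E :: "'a set set"
  assumes "simple_graph V E"
    and "no_isolated_vertices V E"
  shows "(1 \<le> min_degree V E \<and> min_degree V E \<le> 2 \<longrightarrow>
            total_domination_number V E \<le> 2 * min_maximal_matching_number E) \<and>
         (min_degree V E \<ge> 3 \<longrightarrow>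
            int (total_domination_number V E) \<le>
              2 * int (min_maximal_matching_number E) - int (min_degree V E) + 2)"
proof -
  obtain M where M: "maximal_matching E M" "card M = min_maximal_matching_number E"
    using min_maximal_matching_attained[OF assms(1)] .
  have "total_domination_number V E \<le> 2 * min_maximal_matching_number E"
    using total_domination_number_le[OF assms(1) matching_vertices_total_dominating[OF assms M(1)]]
      card_matching_vertices[OF assms(1)] M by (simp add: maximal_matching_def)
  \<comment> \<open>Over the naturals the second bound is again additive; rearranging it gives the
    integer inequality.\<close>
  moreover have "total_domination_number V E + min_degree V E
      \<le> 2 * min_maximal_matching_number E + 2" if three: "3 \<le> min_degree V E"
  proof -
    obtain S where "total_dominating_set V E S" "card S + min_degree V E \<le> 2 * card M + 2"
      by (rule small_total_dominating_set[OF assms(1) M(1), of "min_degree V E"])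
        (use min_degree_le[OF assms(1)] three in auto)
    then show ?thesis
      using total_domination_number_le[OF assms(1), of S] M(2) by linarith
  qed
  ultimately show ?thesis by linarith
qed

end
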